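(* Let $r_1,\dots,r_n>0$ and for $\mathbf{t}=(t_1,\dots,t_{2n})$ let \[T(\mathbf{t},t)=\Big|\sin\tfrac{t-t_1}{2}\Big|^{r_n}\cdots\Big|\sin\tfrac{t-t_n}{2}\Big|^{r_1}\Big|\sin\tfrac{t-t_{n+1}}{2}\Big|^{r_1}\cdots\Big|\sin\tfrac{t-t_{2n}}{2}\Big|^{r_n}.\] Consider the problem of minimizing $\sup_{t\in[0,2\pi]}T(\mathbf{t},t)$ over all $\mathbf{t}$ with $0\le t_1\le\dots\le t_n\le t_{n+1}\le\dots\le t_{2n}\le2\pi$ and $t_1+t_{2n}=2\pi$. Then the infimum is attained at a unique point $\mathbf{w}^*=(w_1,\dots,w_{2n})$, which satisfies $w_1+(w_{2n}-2\pi)=0$ and $0<w_1<\dots<w_{2n}<2\pi$. Furthermore $\mathbf{w}^*$ is symmetric: $w_k=2\pi-w_{2n+1-k}$ for $k=1,\dots,n$. *)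

theory Defs
  imports Complex_Main
begin

definition node_exp :: "nat \<Rightarrow> (nat \<Rightarrow> real) \<Rightarrow> nat \<Rightarrow> real" where
  "node_exp n r k = (if k \<le> n then r (n + 1 - k) else r (k - n))"

definition Tfun :: "nat \<Rightarrow> (nat \<Rightarrow> real) \<Rightarrow> (nat \<Rightarrow> real) \<Rightarrow> real \<Rightarrow> real" where
  "Tfun n r tt x = (\<Prod>k = 1..2*n. \<bar>sin ((x - tt k) / 2)\<bar> powr node_exp n r k)"

definition supT :: "nat \<Rightarrow> (nat \<Rightarrow> real) \<Rightarrow> (nat \<Rightarrow> real) \<Rightarrow> real" where
  "supT n r tt = (SUP x\<in>{0..2*pi}. Tfun n r tt x)"

definition admissible :: "nat \<Rightarrow> (nat \<Rightarrow> real) \<Rightarrow> bool" where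
  "admissible n tt \<longleftrightarrow> 0 \<le> tt 1 \<and> (\<forall>k\<in>{1..<2*n}. tt k \<le> tt (Suc k)) \<and>
     tt (2*n) \<le> 2*pi \<and> tt 1 + tt (2*n) = 2*pi"

end

theory Submission
  imports Defs "HOL-Analysis.Function_Topology" "Jordan_Normal_Form.Determinant"
begin

text \<open>
  Up to a rotation the admissible points are the cyclically ordered \<open>2 n\<close>-tuples of points on the
  circle. Instead of the minimum of the largest of the \<open>2 n\<close> arc maxima one looks at the maximum of
  the smallest one. Let \<open>w\<close> attain it, with value \<open>M\<close>. Then \<open>M > 0\<close>, so no arc of \<open>w\<close> is degenerate,
  and all arc maxima equal \<open>M\<close>: otherwise one could shrink an arc with a larger maximum, which raises
  the product on all other arcs.

  For any other \<open>v\<close>, let \<open>z j\<close> be a critical point in the \<open>j\<close>-th nondegenerate arc of \<open>v\<close>, and \<open>y j\<close>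
  a maximum point in the corresponding arc of \<open>w\<close>. The function \<open>ln \<bar>sin (x / 2)\<bar>\<close> is strictly
  concave, so the difference of \<open>ln T(w, y j)\<close> and \<open>ln T(v, z j)\<close> is less than a linear form in
  \<open>w - v\<close>. There are positive weights \<open>\<lambda> j\<close> for which the weighted sum of these forms vanishes.
  Hence \<open>T(v, z j) > M\<close> for some \<open>j\<close>, so \<open>w\<close> is the only minimizer, and it is symmetric since its
  reflection is a minimizer too.
\<close>

section \<open>Square systems and the dual weights of critical points\<close>

text \<open>Enumerating \<open>J\<close> turns both families into square matrices, for which a
  one-sided inverse is two-sided. In this form orthogonality passes from rows to columns.\<close>

lemma right_inverse_imp_left_inverse_on:
  fixes A B :: "'a \<Rightarrow> 'a \<Rightarrow> 'b::field"
  assumes fin: "finite J"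
    and AB: "\<And>i k. i \<in> J \<Longrightarrow> k \<in> J \<Longrightarrow> (\<Sum>j\<in>J. A i j * B j k) = (if i = k then 1 else 0)"
    and ik: "i \<in> J" "k \<in> J"
  shows "(\<Sum>j\<in>J. B i j * A j k) = (if i = k then 1 else 0)"
proof -
  define p where "p = card J"
  obtain e where e: "bij_betw e {0..<p} J"
    using ex_bij_betw_nat_finite[OF fin] unfolding p_def by blast
  define MA where "MA = mat p p (\<lambda>(a, b). A (e a) (e b))"
  define MB where "MB = mat p p (\<lambda>(a, b). B (e a) (e b))"
  have eJ: "e a \<in> J" if "a < p" for a
    using e that by (auto simp: bij_betw_def)
  have inj: "e a = e b \<longleftrightarrow> a = b" if "a < p" "b < p" for a b
    using e that by (auto simp: bij_betw_def inj_on_def)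
  have reindex: "(\<Sum>j\<in>J. f j) = (\<Sum>a\<in>{0..<p}. f (e a))" for f :: "'a \<Rightarrow> 'b"
    using sum.reindex_bij_betw[OF e, of f] by simp
  have "MA * MB = 1\<^sub>m p"
  proof (rule eq_matI)
    fix a b assume "a < dim_row (1\<^sub>m p :: 'b mat)" "b < dim_col (1\<^sub>m p :: 'b mat)"
    then have ab: "a < p" "b < p" by auto
    have "(MA * MB) $$ (a, b) = (\<Sum>c\<in>{0..<p}. A (e a) (e c) * B (e c) (e b))"
      using ab by (simp add: MA_def MB_def scalar_prod_def)
    also have "\<dots> = (if e a = e b then 1 else 0)"
      using AB[OF eJ eJ, OF ab] by (simp add: reindex)
    finally show "(MA * MB) $$ (a, b) = 1\<^sub>m p $$ (a, b)"
      using ab inj by simp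
  qed (auto simp: MA_def MB_def)
  then have BA: "MB * MA = 1\<^sub>m p"
    by (rule mat_mult_left_right_inverse[rotated 2]) (simp_all add: MA_def MB_def)
  obtain a b where ab: "a < p" "b < p" "i = e a" "k = e b"
    using ik e by (auto simp: bij_betw_def)
  have "(\<Sum>j\<in>J. B i j * A j k) = (MB * MA) $$ (a, b)"
    using ab by (simp add: MA_def MB_def scalar_prod_def reindex)
  also have "\<dots> = (if i = k then 1 else 0)"
    using ab inj by (simp add: BA)
  finally show ?thesis .
qed

lemma cot_diff:
  fixes a b :: real
  assumes "sin a \<noteq> 0" "sin b \<noteq> 0"
  shows "cot a - cot b = sin (b - a) / (sin a * sin b)"
  using assms by (simp add: cot_def sin_diff field_simps)

text \<open>Since \<open>cot a - cot b\<close> is a multiple of \<open>1 / (sin a * sin b)\<close>, the critical point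
  equations say that the rows \<open>1 / sin ((z j - s k) / 2)\<close> are orthogonal for the weights \<open>\<rho>\<close>.
  The matrix is square, so its columns are orthogonal too, for the weights \<open>\<lambda>\<close> given by the
  inverse squared norms of the rows. Read backwards, this says that the sum in the conclusion does
  not depend on \<open>k\<close>; averaging it with the weights \<open>\<rho>\<close> shows that it vanishes.\<close>

lemma cot_critical_duality:
  fixes z s \<rho> :: "'a \<Rightarrow> real"
  assumes fin: "finite J"
    and pos: "\<And>k. k \<in> J \<Longrightarrow> \<rho> k > 0"
    and nz: "\<And>j k. j \<in> J \<Longrightarrow> k \<in> J \<Longrightarrow> sin ((z j - s k) / 2) \<noteq> 0"
    and dist: "\<And>j k. j \<in> J \<Longrightarrow> k \<in> J \<Longrightarrow> j \<noteq> k \<Longrightarrow> sin ((z j - z k) / 2) \<noteq> 0"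
    and crit: "\<And>j. j \<in> J \<Longrightarrow> (\<Sum>k\<in>J. \<rho> k * cot ((z j - s k) / 2)) = 0"
  obtains lam where "\<And>j. j \<in> J \<Longrightarrow> lam j > 0"
    and "\<And>k. k \<in> J \<Longrightarrow> (\<Sum>j\<in>J. lam j * cot ((z j - s k) / 2)) = 0"
proof
  define S where "S j k = sin ((z j - s k) / 2)" for j k
  define lam where "lam j = 1 / (\<Sum>k\<in>J. \<rho> k / (S j k)\<^sup>2)" for j
  have Snz: "S j k \<noteq> 0" if "j \<in> J" "k \<in> J" for j k
    using nz that by (simp add: S_def)
  show lam_pos: "lam j > 0" if "j \<in> J" for j
  proof -
    have "(\<Sum>k\<in>J. \<rho> k / (S j k)\<^sup>2) > 0"
      using fin that pos Snz by (intro sum_pos) auto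
    then show ?thesis by (simp add: lam_def)
  qed
  have orth: "(\<Sum>k\<in>J. (\<rho> k / S i k) * (lam j / S j k)) = (if i = j then 1 else 0)"
    if ij: "i \<in> J" "j \<in> J" for i j
  proof (cases "i = j")
    case True
    have "(\<Sum>k\<in>J. (\<rho> k / S i k) * (lam j / S j k)) = lam j * (\<Sum>k\<in>J. \<rho> k / (S j k)\<^sup>2)"
      by (simp add: True sum_distrib_left power2_eq_square mult_ac)
    also have "\<dots> = 1"
      using lam_pos[OF ij(2)] by (simp add: lam_def)
    finally show ?thesis using True by simp
  next
    case False
    have "0 = (\<Sum>k\<in>J. \<rho> k * (cot ((z i - s k) / 2) - cot ((z j - s k) / 2)))"
      using crit ij by (simp add: right_diff_distrib sum_subtractf)
    also have "\<dots> = (\<Sum>k\<in>J. sin ((z j - z i) / 2) * (\<rho> k / (S i k * S j k)))"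
    proof (rule sum.cong[OF refl])
      fix k assume k: "k \<in> J"
      have "(z j - s k) / 2 - (z i - s k) / 2 = (z j - z i) / 2"
        by (simp add: field_simps)
      note eq = cot_diff[OF nz[OF ij(1) k] nz[OF ij(2) k], unfolded this]
      show "\<rho> k * (cot ((z i - s k) / 2) - cot ((z j - s k) / 2)) =
          sin ((z j - z i) / 2) * (\<rho> k / (S i k * S j k))"
        unfolding eq by (simp add: S_def)
    qed
    finally have "sin ((z j - z i) / 2) * (\<Sum>k\<in>J. \<rho> k / (S i k * S j k)) = 0"
      by (simp add: sum_distrib_left)
    then have 0: "(\<Sum>k\<in>J. \<rho> k / (S i k * S j k)) = 0"
      using dist[OF ij(2,1)] False by simp
    have "(\<Sum>k\<in>J. (\<rho> k / S i k) * (lam j / S j k)) = lam j * (\<Sum>k\<in>J. \<rho> k / (S i k * S j k))"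
      by (simp add: sum_distrib_left mult_ac)
    then show ?thesis using 0 False by simp
  qed
  have orth': "(\<Sum>j\<in>J. (lam j / S j k) * (\<rho> l / S j l)) = (if k = l then 1 else 0)"
    if "k \<in> J" "l \<in> J" for k l
    using right_inverse_imp_left_inverse_on[OF fin,
        of "\<lambda>i k. \<rho> k / S i k" "\<lambda>k j. lam j / S j k", OF orth that] .
  define c where "c k = (\<Sum>j\<in>J. lam j * cot ((z j - s k) / 2))" for k
  have const: "c k = c l" if kl: "k \<in> J" "l \<in> J" for k l
  proof (cases "k = l")
    case False
    have "\<rho> l * (c k - c l) = (\<Sum>j\<in>J. \<rho> l * lam j * (cot ((z j - s k) / 2) - cot ((z j - s l) / 2)))"
      by (simp add: c_def right_diff_distrib sum_subtractf sum_distrib_left mult_ac)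
    also have "\<dots> = (\<Sum>j\<in>J. sin ((s k - s l) / 2) * ((lam j / S j k) * (\<rho> l / S j l)))"
    proof (rule sum.cong[OF refl])
      fix j assume j: "j \<in> J"
      have "(z j - s l) / 2 - (z j - s k) / 2 = (s k - s l) / 2"
        by (simp add: field_simps)
      note eq = cot_diff[OF nz[OF j kl(1)] nz[OF j kl(2)], unfolded this]
      show "\<rho> l * lam j * (cot ((z j - s k) / 2) - cot ((z j - s l) / 2)) =
          sin ((s k - s l) / 2) * ((lam j / S j k) * (\<rho> l / S j l))"
        unfolding eq by (simp add: S_def)
    qed
    also have "\<dots> = 0"
      unfolding sum_distrib_left[symmetric] orth'[OF kl] using False by simp
    finally show ?thesis using pos[OF kl(2)] by simp
  qed simp
  show "c k = 0" if k: "k \<in> J" for k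
  proof -
    have "(\<Sum>l\<in>J. \<rho> l) * c k = (\<Sum>l\<in>J. \<rho> l * c l)"
      by (simp add: sum_distrib_right const[OF k] cong: sum.cong)
    also have "\<dots> = (\<Sum>j\<in>J. lam j * (\<Sum>l\<in>J. \<rho> l * cot ((z j - s l) / 2)))"
      unfolding c_def sum_distrib_left by (subst sum.swap) (simp add: mult_ac)
    also have "\<dots> = 0" by (simp add: crit)
    finally have "(\<Sum>l\<in>J. \<rho> l) * c k = 0" .
    moreover have "(\<Sum>l\<in>J. \<rho> l) > 0" using fin k pos by (intro sum_pos) auto
    ultimately show ?thesis by simp
  qed
qed

section \<open>Concavity of the logarithmic sine\<close>

definition log_sin :: "real \<Rightarrow> real" where
  "log_sin x = ln \<bar>sin (x / 2)\<bar>"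

text \<open>On each of these two intervals \<open>log_sin\<close> is strictly concave. Concavity
  fails across the singularity at 0, so tangent estimates need both arguments on one side of
  it.\<close>

definition same_branch :: "real \<Rightarrow> real \<Rightarrow> bool" where
  "same_branch u v \<longleftrightarrow> u \<in> {0<..<2*pi} \<and> v \<in> {0<..<2*pi} \<or> u \<in> {-2*pi<..<0} \<and> v \<in> {-2*pi<..<0}"

lemma log_sin_minus: "log_sin (- x) = log_sin x"
  by (simp add: log_sin_def)

lemma abs_sin_half_periodic: "\<bar>sin ((x + 2 * pi) / 2)\<bar> = \<bar>sin (x / 2)\<bar>"
  by (simp add: add_divide_distrib)

lemma cot_half_antimono:
  assumes "same_branch u v" "u \<le> v"
  shows "cot (v / 2) \<le> cot (u / 2)"
proof -
  have "sin (u / 2) * sin (v / 2) > 0"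
    using assms(1) sin_gt_zero[of "u / 2"] sin_gt_zero[of "v / 2"]
      sin_gt_zero[of "- u / 2"] sin_gt_zero[of "- v / 2"]
    by (auto simp: same_branch_def mult_neg_neg)
  moreover have "sin (v / 2 - u / 2) \<ge> 0"
    using assms by (intro sin_ge_zero) (auto simp: same_branch_def)
  moreover have "sin (u / 2) \<noteq> 0" "sin (v / 2) \<noteq> 0"
    using calculation(1) by auto
  then have "cot (u / 2) - cot (v / 2) = sin (v / 2 - u / 2) / (sin (u / 2) * sin (v / 2))"
    by (rule cot_diff)
  ultimately show ?thesis
    by (smt (verit) divide_nonneg_pos)
qed

lemma log_sin_has_derivative:
  assumes "sin (x / 2) \<noteq> 0"
  shows "(log_sin has_real_derivative cot (x / 2) / 2) (at x)"
proof -
  \<comment> \<open>The square avoids a case split on the sign of the sine. At its zeros both sides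
    are 0 because \<open>ln 0 = 0\<close>.\<close>
  have eq: "log_sin = (\<lambda>x. ln ((sin (x / 2))\<^sup>2) / 2)"
  proof
    fix x
    show "log_sin x = ln ((sin (x / 2))\<^sup>2) / 2"
      by (cases "sin (x / 2) = 0")
        (use ln_realpow[of "\<bar>sin (x / 2)\<bar>" 2] in \<open>auto simp: log_sin_def\<close>)
  qed
  show ?thesis
    unfolding eq using assms
    by (auto intro!: derivative_eq_intros simp: cot_def power2_eq_square field_simps
        simp flip: not_real_square_gt_zero)
qed

text \<open>By the mean value theorem the increment of \<open>log_sin\<close> is governed by an
  intermediate slope, and the slope \<open>cot (x / 2) / 2\<close> strictly decreases between 0 and
  \<open>2 * pi\<close>.\<close>

lemma log_sin_below_tangent_pos:
  assumes u: "u \<in> {0<..<2*pi}" and v: "v \<in> {0<..<2*pi}" and "u \<noteq> v"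
  shows "log_sin v < log_sin u + cot (u / 2) / 2 * (v - u)"
proof -
  have spos: "sin (x / 2) > 0" if "x \<in> {0<..<2*pi}" for x
    using that by (intro sin_gt_zero) auto
  have D: "(log_sin has_real_derivative cot (x / 2) / 2) (at x)" if "x \<in> {0<..<2*pi}" for x
    using spos[OF that] by (intro log_sin_has_derivative) auto
  have anti: "cot (y / 2) < cot (x / 2)" if "x \<in> {0<..<2*pi}" "y \<in> {0<..<2*pi}" "x < y" for x y
  proof -
    have "sin (y / 2 - x / 2) > 0" using that by (intro sin_gt_zero) auto
    then have "cot (x / 2) - cot (y / 2) > 0"
      using spos[OF that(1)] spos[OF that(2)] by (subst cot_diff) auto
    then show ?thesis by simp
  qed
  show ?thesis
  proof (cases "u < v")
    case True
    then obtain y where y: "u < y" "y < v" "log_sin v - log_sin u = (v - u) * (cot (y / 2) / 2)"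
      using MVT2[of u v log_sin "\<lambda>x. cot (x / 2) / 2"] D u v by auto
    then have "(v - u) * (cot (y / 2) / 2) < (v - u) * (cot (u / 2) / 2)"
      using anti[of u y] u v by (intro mult_strict_left_mono) auto
    with y(3) show ?thesis by argo
  next
    case False
    then have "v < u" using assms by simp
    then obtain y where y: "v < y" "y < u" "log_sin u - log_sin v = (u - v) * (cot (y / 2) / 2)"
      using MVT2[of v u log_sin "\<lambda>x. cot (x / 2) / 2"] D u v by auto
    then have "(u - v) * (cot (y / 2) / 2) > (u - v) * (cot (u / 2) / 2)"
      using anti[of y u] u v by (intro mult_strict_left_mono) auto
    with y(3) show ?thesis by argo
  qed
qed

text \<open>\<open>log_sin\<close> is even, so the negative branch is the mirror image of the
  positive one.\<close>

lemma log_sin_below_tangent: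
  assumes "same_branch u v" "u \<noteq> v"
  shows "log_sin v < log_sin u + cot (u / 2) / 2 * (v - u)"
proof (cases "u > 0")
  case True
  then show ?thesis
    using assms by (intro log_sin_below_tangent_pos) (auto simp: same_branch_def)
next
  case False
  then have "log_sin (- v) < log_sin (- u) + cot (- u / 2) / 2 * (- v - (- u))"
    using assms by (intro log_sin_below_tangent_pos) (auto simp: same_branch_def)
  moreover have "cot (- u / 2) / 2 * (- v - (- u)) = cot (u / 2) / 2 * (v - u)"
    by (simp add: cot_def) argo
  ultimately show ?thesis by (simp add: log_sin_minus)
qed

section \<open>Sine products over cyclically ordered nodes\<close>

definition sin_prod :: "nat \<Rightarrow> (nat \<Rightarrow> real) \<Rightarrow> (nat \<Rightarrow> real) \<Rightarrow> real \<Rightarrow> real" where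
  "sin_prod N q t x = (\<Prod>k = 1..N. \<bar>sin ((x - t k) / 2)\<bar> powr q k)"

text \<open>The entry with index \<open>Suc N\<close> repeats the first node after a full turn, so that all
  \<open>N\<close> arcs of the circle have the form from \<open>t j\<close> to \<open>t (Suc j)\<close>.\<close>

definition cyclic_nodes :: "nat \<Rightarrow> (nat \<Rightarrow> real) \<Rightarrow> bool" where
  "cyclic_nodes N t \<longleftrightarrow> (\<forall>k\<in>{1..N}. t k \<le> t (Suc k)) \<and> t (Suc N) = t 1 + 2 * pi"

lemma cyclic_nodes_mono:
  assumes "cyclic_nodes N t" "1 \<le> i" "i \<le> j" "j \<le> Suc N"
  shows "t i \<le> t j"
  using assms(3,4)
proof (induction j rule: dec_induct)
  case (step m)
  then have "t m \<le> t (Suc m)" using assms(1,2) by (auto simp: cyclic_nodes_def)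
  with step show ?case by simp
qed simp

lemma cyclic_nodes_arc:
  assumes c: "cyclic_nodes N t" and i: "i \<in> {1..N}" and j: "j \<in> {1..N}"
    and x: "x \<in> {t j<..<t (Suc j)}"
  shows "i \<le> j \<Longrightarrow> x - t i \<in> {0<..<2*pi}" and "j < i \<Longrightarrow> x - t i \<in> {-2*pi<..<0}"
proof -
  have end_eq: "t (Suc N) = t 1 + 2 * pi" using c by (simp add: cyclic_nodes_def)
  have bounds: "t 1 \<le> t i" "t i \<le> t (Suc N)" "t 1 \<le> t j" "t (Suc j) \<le> t (Suc N)"
    using i j by (auto intro!: cyclic_nodes_mono[OF c])
  show "x - t i \<in> {0<..<2*pi}" if "i \<le> j"
  proof -
    have "t i \<le> t j" using that i j by (intro cyclic_nodes_mono[OF c]) auto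
    then show ?thesis using x bounds end_eq by auto
  qed
  show "x - t i \<in> {-2*pi<..<0}" if "j < i"
  proof -
    have "t (Suc j) \<le> t i" using that i j by (intro cyclic_nodes_mono[OF c]) auto
    then show ?thesis using x bounds end_eq by auto
  qed
qed

text \<open>The branch of \<open>x - t i\<close> is decided by the order of the indices
  \<open>i\<close> and \<open>j\<close> alone. Hence two node systems can be compared factor by
  factor through tangents, as long as the two points lie in arcs with the same index.\<close>

lemma same_branch_arcs:
  assumes "cyclic_nodes N t" "cyclic_nodes N w" "i \<in> {1..N}" "j \<in> {1..N}"
    and "x \<in> {t j<..<t (Suc j)}" "y \<in> {w j<..<w (Suc j)}"
  shows "same_branch (x - t i) (y - w i)"
  using cyclic_nodes_arc[OF assms(1,3,4,5)] cyclic_nodes_arc[OF assms(2,3,4,6)]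
  unfolding same_branch_def by (cases "i \<le> j") auto

lemma same_branch_sin_nonzero:
  assumes "same_branch u v"
  shows "sin (u / 2) \<noteq> 0"
  using assms sin_gt_zero[of "u / 2"] sin_gt_zero[of "- u / 2"] by (auto simp: same_branch_def)

lemma sin_nonzero_arc:
  assumes "cyclic_nodes N t" "i \<in> {1..N}" "j \<in> {1..N}" "x \<in> {t j<..<t (Suc j)}"
  shows "sin ((x - t i) / 2) \<noteq> 0"
  using same_branch_arcs[OF assms(1,1,2,3,4,4)] by (rule same_branch_sin_nonzero)

lemma sin_prod_nonneg: "sin_prod N q t x \<ge> 0"
  by (auto simp: sin_prod_def intro!: prod_nonneg)

lemma sin_prod_pos:
  assumes "\<And>k. k \<in> {1..N} \<Longrightarrow> sin ((x - t k) / 2) \<noteq> 0"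
  shows "sin_prod N q t x > 0"
  unfolding sin_prod_def using assms by (intro prod_pos) auto

lemma sin_prod_eq_0:
  assumes "k \<in> {1..N}" "sin ((x - t k) / 2) = 0"
  shows "sin_prod N q t x = 0"
  unfolding sin_prod_def using assms by (intro prod_zero) (auto intro!: bexI[of _ k])

lemma sin_prod_le_1:
  assumes "\<And>k. k \<in> {1..N} \<Longrightarrow> q k > 0"
  shows "sin_prod N q t x \<le> 1"
  unfolding sin_prod_def
proof (rule prod_le_1)
  fix k assume "k \<in> {1..N}"
  then show "0 \<le> \<bar>sin ((x - t k) / 2)\<bar> powr q k \<and> \<bar>sin ((x - t k) / 2)\<bar> powr q k \<le> 1"
    using assms[of k] powr_mono2[of "q k" "\<bar>sin ((x - t k) / 2)\<bar>" 1] by auto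
qed

lemma sin_prod_cong:
  assumes "\<And>k. k \<in> {1..N} \<Longrightarrow> t k = t' k"
  shows "sin_prod N q t x = sin_prod N q t' x"
  unfolding sin_prod_def using assms by (intro prod.cong) auto

lemma sin_prod_shift: "sin_prod N q (\<lambda>k. t k + c) (x + c) = sin_prod N q t x"
  by (simp add: sin_prod_def)

lemma sin_prod_periodic: "sin_prod N q t (x + 2 * pi) = sin_prod N q t x"
proof -
  have "x + 2 * pi - t k = (x - t k) + 2 * pi" for k by simp
  then show ?thesis unfolding sin_prod_def by (simp only: abs_sin_half_periodic)
qed

lemma sin_prod_arc_end:
  assumes "cyclic_nodes N t" "j \<in> {1..N}"
  shows "sin_prod N q t (t j) = 0" "sin_prod N q t (t (Suc j)) = 0"
proof -
  have zero: "sin_prod N q t (t k) = 0" if "k \<in> {1..N}" for k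
    using that by (rule sin_prod_eq_0) simp
  show "sin_prod N q t (t j) = 0" using zero assms by simp
  show "sin_prod N q t (t (Suc j)) = 0"
  proof (cases "j = N")
    case True
    then have "sin_prod N q t (t (Suc j)) = sin_prod N q t (t 1 + 2 * pi)"
      using assms by (simp add: cyclic_nodes_def)
    also have "\<dots> = 0" using zero[of 1] assms unfolding sin_prod_periodic by auto
    finally show ?thesis .
  next
    case False
    then show ?thesis using zero[of "Suc j"] assms by auto
  qed
qed

lemma ln_sin_prod:
  assumes "\<And>k. k \<in> {1..N} \<Longrightarrow> sin ((x - t k) / 2) \<noteq> 0"
  shows "ln (sin_prod N q t x) = (\<Sum>k = 1..N. q k * log_sin (x - t k))"
  unfolding sin_prod_def using assms by (subst ln_prod) (auto simp: log_sin_def ln_powr)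

text \<open>Nodes and point vary together: compactness in the maximin problem needs joint
  continuity, the perturbation of nodes needs continuity in the displacement. Positive exponents
  keep \<open>powr\<close> continuous where the base vanishes.\<close>

lemma sin_prod_continuous:
  assumes "\<And>k. k \<in> {1..N} \<Longrightarrow> q k > 0"
    and "\<And>k. k \<in> {1..N} \<Longrightarrow> continuous_on S (\<lambda>p. t p k)" and "continuous_on S x"
  shows "continuous_on S (\<lambda>p. sin_prod N q (t p) (x p))"
  unfolding sin_prod_def
proof (rule continuous_on_prod)
  fix k assume k: "k \<in> {1..N}"
  show "continuous_on S (\<lambda>p. \<bar>sin ((x p - t p k) / 2)\<bar> powr q k)"
  proof (rule continuous_on_powr')
    have "continuous_on S (\<lambda>p. (x p - t p k) / 2)"
      by (intro continuous_intros assms(2)[OF k] assms(3)) auto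
    then show "continuous_on S (\<lambda>p. \<bar>sin ((x p - t p k) / 2)\<bar>)"
      by (intro continuous_on_rabs continuous_on_compose2[OF continuous_on_sin[OF continuous_on_id]]) auto
  qed (use assms(1)[OF k] in auto)
qed

section \<open>Critical points and the comparison of two node systems\<close>

text \<open>The product vanishes at both ends of the arc and is positive inside, so its maximum is
  interior. There the derivative of its logarithm, half the cotangent sum, is zero.\<close>

lemma ex_critical_point:
  assumes c: "cyclic_nodes N t" and j: "j \<in> {1..N}" and less: "t j < t (Suc j)"
    and q: "\<And>k. k \<in> {1..N} \<Longrightarrow> q k > 0"
  obtains z where "z \<in> {t j<..<t (Suc j)}" "(\<Sum>k = 1..N. q k * cot ((z - t k) / 2)) = 0"
proof -
  let ?a = "t j" and ?b = "t (Suc j)"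
  have "continuous_on {?a..?b} (sin_prod N q t)"
    by (rule sin_prod_continuous) (auto simp: q continuous_on_id)
  then obtain z where z: "z \<in> {?a..?b}" and zmax: "\<And>x. x \<in> {?a..?b} \<Longrightarrow> sin_prod N q t x \<le> sin_prod N q t z"
    using continuous_attains_sup[of "{?a..?b}" "sin_prod N q t"] less by auto
  have pos: "sin_prod N q t x > 0" if "x \<in> {?a<..<?b}" for x
    using sin_nonzero_arc[OF c _ j that] by (intro sin_prod_pos) auto
  have "sin_prod N q t ((?a + ?b) / 2) > 0" using less by (intro pos) auto
  then have "sin_prod N q t z > 0" using zmax[of "(?a + ?b) / 2"] less by auto
  then have "z \<noteq> ?a" "z \<noteq> ?b" using sin_prod_arc_end[OF c j, of q] by auto
  with z have z': "z \<in> {?a<..<?b}" by auto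
  define F where "F x = (\<Sum>k = 1..N. q k * log_sin (x - t k))" for x
  have F: "F x = ln (sin_prod N q t x)" if "x \<in> {?a<..<?b}" for x
    using sin_nonzero_arc[OF c _ j that] unfolding F_def by (subst ln_sin_prod) auto
  have "(F has_real_derivative (\<Sum>k = 1..N. q k * (cot ((z - t k) / 2) / 2))) (at z)"
    unfolding F_def
  proof (rule DERIV_sum)
    fix k assume k: "k \<in> {1..N}"
    have "((\<lambda>x. log_sin (x - t k)) has_real_derivative cot ((z - t k) / 2) / 2) (at z)"
      using DERIV_shift[of log_sin "cot ((z - t k) / 2) / 2" z "- t k"]
        log_sin_has_derivative[OF sin_nonzero_arc[OF c k j z']] by simp
    then show "((\<lambda>x. q k * log_sin (x - t k)) has_real_derivative q k * (cot ((z - t k) / 2) / 2)) (at z)"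
      by (rule DERIV_cmult)
  qed
  moreover have "\<forall>x. \<bar>z - x\<bar> < min (z - ?a) (?b - z) \<longrightarrow> F x \<le> F z"
  proof (intro allI impI)
    fix x assume "\<bar>z - x\<bar> < min (z - ?a) (?b - z)"
    then have x: "x \<in> {?a<..<?b}" by auto
    show "F x \<le> F z"
      using zmax[of x] pos[OF x] pos[OF z'] x unfolding F[OF x] F[OF z'] by auto
  qed
  ultimately have "(\<Sum>k = 1..N. q k * (cot ((z - t k) / 2) / 2)) = 0"
    using z' by (intro DERIV_local_max[of F _ z "min (z - ?a) (?b - z)"]) auto
  then have "(\<Sum>k = 1..N. q k * cot ((z - t k) / 2)) = 0"
    by (simp flip: sum_divide_distrib)
  with z' show ?thesis by (rule that)
qed

text \<open>The last index of a block of equal nodes starts a nondegenerate arc. A block that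
  reaches index \<open>Suc N\<close> continues, one turn earlier, at node 1; hence the alternative
  with \<open>2 * pi\<close>.\<close>

lemma ex_nondegenerate_arc:
  assumes c: "cyclic_nodes N v" and i: "i \<in> {1..N}"
  shows "\<exists>j\<in>{1..N}. v j < v (Suc j) \<and> (v i = v j \<or> v i = v j + 2 * pi)"
proof -
  have last: "\<exists>j\<in>{1..N}. v j < v (Suc j) \<and> v j = v k" if k: "k \<in> {1..N}" "v k \<noteq> v (Suc N)" for k
  proof -
    define j where "j = Max {j \<in> {1..N}. v j = v k}"
    have "j \<in> {j \<in> {1..N}. v j = v k}"
      unfolding j_def using k by (intro Max_in) auto
    then have j: "j \<in> {1..N}" "v j = v k" by auto
    have "v (Suc j) \<noteq> v k"
    proof (cases "j = N")
      case False
      show ?thesis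
      proof
        assume "v (Suc j) = v k"
        then have "Suc j \<le> j"
          unfolding j_def using j False by (intro Max_ge) (auto simp: j_def)
        then show False by simp
      qed
    qed (use k in auto)
    moreover have "v j \<le> v (Suc j)" using c j(1) unfolding cyclic_nodes_def by blast
    ultimately show ?thesis using j by (intro bexI[of _ j]) auto
  qed
  show ?thesis
  proof (cases "v i = v (Suc N)")
    case True
    then obtain j where "j \<in> {1..N}" "v j < v (Suc j)" "v j = v 1"
      using last[of 1] i c by (auto simp: cyclic_nodes_def)
    then show ?thesis using True c by (intro bexI[of _ j]) (auto simp: cyclic_nodes_def)
  next
    case False
    then show ?thesis using last[of i] i by force
  qed
qed

lemma cot_half_add_2pi: "cot ((x - (s + 2 * pi)) / 2) = cot ((x - s) / 2)"
proof -
  have "(x - (s + 2 * pi)) / 2 = (x - s) / 2 - pi" by (simp add: field_simps)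
  then show ?thesis by (simp only: cot_def sin_diff cos_diff) simp
qed

text \<open>Arcs of \<open>v\<close> may be degenerate. Coinciding nodes are merged and their
  exponents added, which leaves as many distinct nodes as nondegenerate arcs, so that the duality
  lemma applies. The hypothesis \<open>norm\<close> rules out that \<open>v\<close> is a translate
  of \<open>w\<close>.\<close>

lemma cyclic_nodes_comparison:
  assumes v: "cyclic_nodes N v" and w: "cyclic_nodes N w"
    and q: "\<And>k. k \<in> {1..N} \<Longrightarrow> q k > 0"
    and norm: "v 1 + v N = w 1 + w N"
    and neq: "i0 \<in> {1..N}" "v i0 \<noteq> w i0"
    and y: "\<And>j. j \<in> {1..N} \<Longrightarrow> y j \<in> {w j<..<w (Suc j)}"
  obtains j x where "j \<in> {1..N}" "x \<in> {v 1..v 1 + 2 * pi}" "sin_prod N q w (y j) < sin_prod N q v x"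
proof -
  define J where "J = {j \<in> {1..N}. v j < v (Suc j)}"
  have J: "j \<in> {1..N}" "v j < v (Suc j)" if "j \<in> J" for j using that by (auto simp: J_def)
  have finJ: "finite J" by (simp add: J_def)
  \<comment> \<open>The index \<open>j\<close> is the representative in \<open>J\<close> of the
    point \<open>v i\<close> on the circle. Fixing the elements of \<open>J\<close> makes every
    merged weight below a nonempty sum.\<close>
  have "\<forall>i\<in>{1..N}. \<exists>j. j \<in> J \<and> (i \<in> J \<longrightarrow> j = i) \<and> (v i = v j \<or> v i = v j + 2 * pi)"
  proof
    fix i assume i: "i \<in> {1..N}"
    obtain j where "j \<in> J" "v i = v j \<or> v i = v j + 2 * pi"
      using ex_nondegenerate_arc[OF v i] unfolding J_def by blast
    then show "\<exists>j. j \<in> J \<and> (i \<in> J \<longrightarrow> j = i) \<and> (v i = v j \<or> v i = v j + 2 * pi)"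
      by (cases "i \<in> J") auto
  qed
  from bchoice[OF this] obtain c where "\<forall>i\<in>{1..N}. c i \<in> J \<and> (i \<in> J \<longrightarrow> c i = i) \<and>
      (v i = v (c i) \<or> v i = v (c i) + 2 * pi)"
    by blast
  then have c: "\<And>i. i \<in> {1..N} \<Longrightarrow> c i \<in> J" "\<And>i. i \<in> J \<Longrightarrow> c i = i"
    "\<And>i. i \<in> {1..N} \<Longrightarrow> v i = v (c i) \<or> v i = v (c i) + 2 * pi"
    using J(1) by blast+
  have cot_c: "cot ((x - v i) / 2) = cot ((x - v (c i)) / 2)" if "i \<in> {1..N}" for x i
    using c(3)[OF that] cot_half_add_2pi[of x "v (c i)"] by auto
  have "\<forall>j\<in>J. \<exists>z. z \<in> {v j<..<v (Suc j)} \<and> (\<Sum>k = 1..N. q k * cot ((z - v k) / 2)) = 0"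
  proof
    fix j assume j: "j \<in> J"
    show "\<exists>z. z \<in> {v j<..<v (Suc j)} \<and> (\<Sum>k = 1..N. q k * cot ((z - v k) / 2)) = 0"
      by (rule ex_critical_point[where q = q, OF v J[OF j] q]) auto
  qed
  from bchoice[OF this] obtain z where z: "\<And>j. j \<in> J \<Longrightarrow> z j \<in> {v j<..<v (Suc j)}"
    and crit: "\<And>j. j \<in> J \<Longrightarrow> (\<Sum>k = 1..N. q k * cot ((z j - v k) / 2)) = 0"
    by blast
  define \<rho> where "\<rho> k = (\<Sum>i | i \<in> {1..N} \<and> c i = k. q i)" for k
  have "\<rho> k > 0" if "k \<in> J" for k
    unfolding \<rho>_def using J(1)[OF that] c(2)[OF that] q by (intro sum_pos) auto
  moreover have "sin ((z j - v k) / 2) \<noteq> 0" if "j \<in> J" "k \<in> J" for j k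
    using sin_nonzero_arc[OF v _ _ z] J that by blast
  moreover have "sin ((z j - z k) / 2) \<noteq> 0" if jk: "j \<in> J" "k \<in> J" "j \<noteq> k" for j k
  proof -
    have odd: "sin ((z j - z k) / 2) = - sin ((z k - z j) / 2)" for j k
      by (metis minus_diff_eq minus_divide_left sin_minus)
    have less: "sin ((z j - z k) / 2) < 0" if jk: "j \<in> J" "k \<in> J" "j < k" for j k
    proof -
      note jN = J(1)[OF jk(1)] and kN = J(1)[OF jk(2)]
      have "v (Suc j) \<le> v k" using jk jN kN by (intro cyclic_nodes_mono[OF v]) auto
      moreover have "z k - v 1 < 2 * pi"
        using cyclic_nodes_arc(1)[OF v _ kN z[OF jk(2)], of 1] kN by auto
      moreover have "v 1 \<le> v j" using jN by (intro cyclic_nodes_mono[OF v]) auto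
      ultimately have "sin ((z k - z j) / 2) > 0"
        using z[OF jk(1)] z[OF jk(2)] by (intro sin_gt_zero) auto
      then show ?thesis using odd[of j k] by simp
    qed
    show ?thesis
    proof (cases "j < k")
      case True
      then show ?thesis using less jk by force
    next
      case False
      then have "sin ((z k - z j) / 2) < 0" using less jk by force
      then show ?thesis using odd[of j k] by simp
    qed
  qed
  moreover have "(\<Sum>k\<in>J. \<rho> k * cot ((z j - v k) / 2)) = 0" if "j \<in> J" for j
  proof -
    have "(\<Sum>k\<in>J. \<rho> k * cot ((z j - v k) / 2)) =
        (\<Sum>k\<in>J. \<Sum>i | i \<in> {1..N} \<and> c i = k. q i * cot ((z j - v i) / 2))"
      unfolding \<rho>_def sum_distrib_right by (intro sum.cong refl) (auto simp: cot_c)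
    also have "\<dots> = (\<Sum>i = 1..N. q i * cot ((z j - v i) / 2))"
      using finJ c(1) by (intro sum.group) auto
    finally show ?thesis using crit[OF that] by simp
  qed
  ultimately obtain lam where lam_pos: "\<And>j. j \<in> J \<Longrightarrow> lam j > 0"
    and lamJ: "\<And>k. k \<in> J \<Longrightarrow> (\<Sum>j\<in>J. lam j * cot ((z j - v k) / 2)) = 0"
    using cot_critical_duality[OF finJ, of \<rho> z v] by blast
  have lam: "(\<Sum>j\<in>J. lam j * cot ((z j - v i) / 2)) = 0" if "i \<in> {1..N}" for i
    using lamJ[OF c(1)[OF that]] cot_c[OF that] by simp
  \<comment> \<open>\<open>E j\<close> is the tangent bound without its part in
    \<open>y j - z j\<close>: the coefficient of that part is a multiple of the critical sum at
    \<open>z j\<close>, which is zero.\<close>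
  define E where "E j = - (\<Sum>i = 1..N. q i * (cot ((z j - v i) / 2) / 2) * (w i - v i))" for j
  have lt_E: "ln (sin_prod N q w (y j)) - ln (sin_prod N q v (z j)) < E j" if j: "j \<in> J" for j
  proof -
    note jN = J(1)[OF j]
    let ?u = "\<lambda>i. z j - v i" and ?v = "\<lambda>i. y j - w i"
    have branch: "same_branch (?u i) (?v i)" if "i \<in> {1..N}" for i
      using same_branch_arcs[OF v w that jN z[OF j] y[OF jN]] .
    have le: "log_sin (?v i) - log_sin (?u i) \<le> cot (?u i / 2) / 2 * (?v i - ?u i)"
      and less: "?u i \<noteq> ?v i \<Longrightarrow> log_sin (?v i) - log_sin (?u i) < cot (?u i / 2) / 2 * (?v i - ?u i)"
      if "i \<in> {1..N}" for i
      using log_sin_below_tangent[OF branch[OF that]] by force+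
    \<comment> \<open>If every tangent were evaluated at its point of contact, \<open>w\<close>
      would be \<open>v\<close> translated by \<open>y j - z j\<close>. Equal sums of first and last
      nodes make this translation zero, against \<open>neq\<close>.\<close>
    have "\<exists>i\<in>{1..N}. ?u i \<noteq> ?v i"
    proof (rule ccontr)
      assume "\<not> ?thesis"
      then have eq: "z j - v i = y j - w i" if "i \<in> {1..N}" for i using that by blast
      have "z j = y j" using eq[of 1] eq[of N] norm neq(1) by auto
      then show False using eq[OF neq(1)] neq(2) by simp
    qed
    then obtain i1 where i1: "i1 \<in> {1..N}" "?u i1 \<noteq> ?v i1" by blast
    have "ln (sin_prod N q w (y j)) = (\<Sum>i = 1..N. q i * log_sin (?v i))"
      using sin_nonzero_arc[OF w _ jN y[OF jN]] by (rule ln_sin_prod)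
    moreover have "ln (sin_prod N q v (z j)) = (\<Sum>i = 1..N. q i * log_sin (?u i))"
      using sin_nonzero_arc[OF v _ jN z[OF j]] by (rule ln_sin_prod)
    ultimately have "ln (sin_prod N q w (y j)) - ln (sin_prod N q v (z j)) =
        (\<Sum>i = 1..N. q i * (log_sin (?v i) - log_sin (?u i)))"
      by (simp add: right_diff_distrib sum_subtractf)
    also have "\<dots> < (\<Sum>i = 1..N. q i * (cot (?u i / 2) / 2 * (?v i - ?u i)))"
    proof (rule sum_strict_mono_ex1)
      show "\<forall>i\<in>{1..N}. q i * (log_sin (?v i) - log_sin (?u i)) \<le> q i * (cot (?u i / 2) / 2 * (?v i - ?u i))"
        using le q by (intro ballI mult_left_mono) (auto simp: less_imp_le)
      show "\<exists>i\<in>{1..N}. q i * (log_sin (?v i) - log_sin (?u i)) < q i * (cot (?u i / 2) / 2 * (?v i - ?u i))"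
        using i1 less[OF i1] q by (intro bexI[of _ i1] mult_strict_left_mono) auto
    qed simp
    also have "\<dots> = (\<Sum>i = 1..N. (y j - z j) / 2 * (q i * cot (?u i / 2))
        - q i * (cot (?u i / 2) / 2) * (w i - v i))"
      by (intro sum.cong refl) (simp add: field_simps)
    also have "\<dots> = E j"
      unfolding sum_subtractf sum_distrib_left[symmetric] crit[OF j] E_def by simp
    finally show ?thesis .
  qed
  \<comment> \<open>Exchanging the sums collects the factor of each \<open>w i - v i\<close>, which
    the weights \<open>lam\<close> annihilate.\<close>
  have "(\<Sum>j\<in>J. lam j * E j) = - (\<Sum>j\<in>J. \<Sum>i = 1..N. (q i * (w i - v i) / 2) * (lam j * cot ((z j - v i) / 2)))"
    by (simp add: E_def sum_distrib_left sum_negf mult_ac)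
  also have "\<dots> = - (\<Sum>i = 1..N. (q i * (w i - v i) / 2) * (\<Sum>j\<in>J. lam j * cot ((z j - v i) / 2)))"
    by (subst sum.swap) (simp only: sum_distrib_left)
  also have "(\<Sum>i = 1..N. (q i * (w i - v i) / 2) * (\<Sum>j\<in>J. lam j * cot ((z j - v i) / 2))) = 0"
    by (intro sum.neutral ballI) (simp add: lam)
  finally have sumE: "(\<Sum>j\<in>J. lam j * E j) = 0" by simp
  have ex: "\<exists>j\<in>J. sin_prod N q w (y j) < sin_prod N q v (z j)"
  proof (rule ccontr)
    assume neg: "\<not> ?thesis"
    have "E j > 0" if "j \<in> J" for j
    proof -
      have "sin_prod N q v (z j) > 0"
        using sin_nonzero_arc[OF v _ J(1)[OF that] z[OF that]] by (intro sin_prod_pos)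
      moreover have "sin_prod N q v (z j) \<le> sin_prod N q w (y j)"
        using neg that by force
      ultimately have "ln (sin_prod N q v (z j)) \<le> ln (sin_prod N q w (y j))" by simp
      with lt_E[OF that] show ?thesis by simp
    qed
    \<comment> \<open>The sum is not empty, since \<open>J\<close> contains
      \<open>c i0\<close>.\<close>
    then have "(\<Sum>j\<in>J. lam j * E j) > 0"
      using finJ c(1)[OF neq(1)] lam_pos by (intro sum_pos) auto
    with sumE show False by simp
  qed
  have "z j \<in> {v 1..v 1 + 2 * pi}" if "j \<in> J" for j
    using cyclic_nodes_arc(1)[OF v _ J(1)[OF that] z[OF that], of 1] J(1)[OF that] by auto
  then show ?thesis using that ex J(1) by blast
qed

section \<open>Existence of equioscillating nodes\<close>

text \<open>Nodes, one sample point per arc and a level below all sampled values are varied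
  together. Maximizing the level over such triples maximizes the smallest arc maximum, without
  treating arc maxima as functions of the nodes.\<close>

lemma ex_maximin:
  assumes N: "N \<ge> 1" and q: "\<And>k. k \<in> {1..N} \<Longrightarrow> q k > 0"
  obtains w y M where "cyclic_nodes N w" "\<And>j. j \<in> {1..N} \<Longrightarrow> y j \<in> {w j..w (Suc j)}"
    "\<And>j. j \<in> {1..N} \<Longrightarrow> M \<le> sin_prod N q w (y j)"
    "\<And>t x m. cyclic_nodes N t \<Longrightarrow> (\<And>j. j \<in> {1..N} \<Longrightarrow> x j \<in> {t j..t (Suc j)}) \<Longrightarrow>
       (\<And>j. j \<in> {1..N} \<Longrightarrow> m \<le> sin_prod N q t (x j)) \<Longrightarrow> m \<le> M"
proof -
  \<comment> \<open>The sequences with values between 0 and \<open>2 * pi\<close> form a compact set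
    by Tychonoff's theorem.\<close>
  define B where "B = PiE (UNIV :: nat set) (\<lambda>_. {0..2*pi})"
  have "compactin (product_topology (\<lambda>_. euclidean) UNIV) B"
    unfolding B_def compactin_PiE by simp
  then have compB: "compact B" by (simp add: euclidean_product_topology)
  define K where "K = {p :: (nat \<Rightarrow> real) \<times> (nat \<Rightarrow> real) \<times> real.
     (\<forall>k\<in>{1..N}. fst p k \<le> fst p (Suc k)) \<and> fst p (Suc N) = fst p 1 + 2 * pi \<and>
     (\<forall>j\<in>{1..N}. fst p j \<le> fst (snd p) j \<and> fst (snd p) j \<le> fst p (Suc j) \<and>
       snd (snd p) \<le> sin_prod N q (fst p) (fst (snd p) j))}"
  have c1: "continuous_on UNIV (\<lambda>p :: (nat \<Rightarrow> real) \<times> (nat \<Rightarrow> real) \<times> real. fst p k)" for k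
    by (rule continuous_on_product_then_coordinatewise) (intro continuous_intros)
  have c2: "continuous_on UNIV (\<lambda>p :: (nat \<Rightarrow> real) \<times> (nat \<Rightarrow> real) \<times> real. fst (snd p) k)" for k
    by (rule continuous_on_product_then_coordinatewise) (intro continuous_intros)
  have c3: "continuous_on S (\<lambda>p :: (nat \<Rightarrow> real) \<times> (nat \<Rightarrow> real) \<times> real. snd (snd p))" for S
    by (intro continuous_intros)
  have "closed K"
    unfolding K_def Ball_def
    by (intro closed_Collect_conj closed_Collect_all closed_Collect_imp closed_Collect_le
        closed_Collect_eq continuous_on_add continuous_on_const c1 c2 c3 sin_prod_continuous q) auto
  then have comp: "compact (B \<times> B \<times> {0..1} \<inter> K)"
    by (intro compact_Int_closed compact_Times compB) auto
  \<comment> \<open>All nodes collapse at 0, and index \<open>Suc N\<close> holds the same point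
    after a full turn. Level 0 is allowed since the product is nonnegative.\<close>
  have "((\<lambda>k. if k \<le> N then 0 else 2 * pi), (\<lambda>_. 0), 0) \<in> B \<times> B \<times> {0..1} \<inter> K"
    using N by (auto simp: B_def K_def sin_prod_nonneg)
  then have "B \<times> B \<times> {0..1} \<inter> K \<noteq> {}" by blast
  then obtain p where p: "p \<in> B \<times> B \<times> {0..1} \<inter> K"
    and pmax: "\<And>p'. p' \<in> B \<times> B \<times> {0..1} \<inter> K \<Longrightarrow> snd (snd p') \<le> snd (snd p)"
    using continuous_attains_sup[OF comp _ c3] by blast
  obtain w y M where p_eq: "p = (w, y, M)" by (cases p) auto
  show ?thesis
  proof (rule that[of w y M])
    show "cyclic_nodes N w" using p by (auto simp: p_eq K_def cyclic_nodes_def)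
    show "y j \<in> {w j..w (Suc j)}" "M \<le> sin_prod N q w (y j)" if "j \<in> {1..N}" for j
      using p that by (auto simp: p_eq K_def)
    fix t x m
    assume t: "cyclic_nodes N t" and x: "\<And>j. j \<in> {1..N} \<Longrightarrow> x j \<in> {t j..t (Suc j)}"
      and m: "\<And>j. j \<in> {1..N} \<Longrightarrow> m \<le> sin_prod N q t (x j)"
    show "m \<le> M"
    proof (cases "m \<ge> 0")
      case True
      \<comment> \<open>Translating the first node to 0 keeps the products and brings nodes and
        samples into the box; the value 0 at the remaining indices keeps the whole sequence
        there.\<close>
      define t' where "t' k = (if k \<in> {1..Suc N} then t k - t 1 else 0)" for k
      define x' where "x' j = (if j \<in> {1..N} then x j - t 1 else 0)" for j
      have eq: "sin_prod N q t' (x' j) = sin_prod N q t (x j)" if "j \<in> {1..N}" for j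
      proof -
        have "sin_prod N q t' (x' j) = sin_prod N q (\<lambda>k. t k + (- t 1)) (x j + (- t 1))"
          using that unfolding x'_def by (subst sin_prod_cong[of N t' "\<lambda>k. t k + (- t 1)"]) (auto simp: t'_def)
        then show ?thesis unfolding sin_prod_shift .
      qed
      have tB: "t k - t 1 \<in> {0..2*pi}" if "k \<in> {1..Suc N}" for k
        using cyclic_nodes_mono[OF t, of 1 k] cyclic_nodes_mono[OF t, of k "Suc N"] that t
        by (auto simp: cyclic_nodes_def)
      have xB: "x j - t 1 \<in> {0..2*pi}" if "j \<in> {1..N}" for j
        using tB[of j] tB[of "Suc j"] x[OF that] that by auto
      have "t' \<in> B" using tB by (auto simp: B_def t'_def)
      moreover have "x' \<in> B" using xB by (auto simp: B_def x'_def)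
      moreover have "m \<le> 1"
        using m[of 1] sin_prod_le_1[of N q t "x 1"] q N by force
      moreover have "(t', x', m) \<in> K"
        using t m x eq N by (auto simp: K_def cyclic_nodes_def t'_def x'_def)
      ultimately show ?thesis using pmax[of "(t', x', m)"] True by (simp add: p_eq)
    next
      case False
      then show ?thesis using p by (simp add: p_eq)
    qed
  qed
qed

lemma ex_strict_lower_bound:
  fixes f :: "'a \<Rightarrow> real"
  assumes "finite A" "\<And>a. a \<in> A \<Longrightarrow> M < f a"
  obtains m where "m > M" "\<And>a. a \<in> A \<Longrightarrow> m \<le> f a"
proof (cases "A = {}")
  case True
  then show ?thesis using that[of "M + 1"] by simp
next
  case False
  then show ?thesis using that[of "Min (f ` A)"] assms by simp
qed

text \<open>In \<open>w'\<close> the endpoints of the \<open>j\<close>-th arc have moved inwards, at speeds inverse to their weights;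
  the first order terms then reduce to a difference of two cotangents, whose sign is known outside
  that arc.\<close>

lemma sin_prod_shrink_arc:
  assumes w: "cyclic_nodes N w" and w': "cyclic_nodes N w'"
    and q: "\<And>k. k \<in> {1..N} \<Longrightarrow> q k > 0"
    and ij: "i \<in> {1..N}" "j \<in> {1..N}" "i \<noteq> j"
    and y: "y \<in> {w i<..<w (Suc i)}" "y \<in> {w' i<..<w' (Suc i)}"
    and b: "b = (if j = N then 1 else Suc j)" and eps: "\<epsilon> > 0"
    and move: "\<And>k. k \<in> {1..N} \<Longrightarrow>
      w' k = w k + \<epsilon> * ((if k = j then 1 / q j else 0) - (if k = b then 1 / q b else 0))"
  shows "sin_prod N q w y < sin_prod N q w' y"
proof -
  \<comment> \<open>The distinct indices \<open>i\<close> and \<open>j\<close> force at least two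
    nodes, so \<open>b\<close> differs from \<open>j\<close> even when it wraps around.\<close>
  have bN: "b \<in> {1..N}" and "b \<noteq> j" using ij b by auto
  let ?u = "\<lambda>k. y - w' k" and ?v = "\<lambda>k. y - w k"
  have less: "log_sin (?v k) < log_sin (?u k) + cot (?u k / 2) / 2 * (?v k - ?u k)"
    if "k \<in> {1..N}" "?u k \<noteq> ?v k" for k
    using log_sin_below_tangent[OF same_branch_arcs[OF w' w that(1) ij(1) y(2,1)] that(2)] .
  have "w' j \<noteq> w j" using move[OF ij(2)] q[OF ij(2)] eps \<open>b \<noteq> j\<close> by auto
  \<comment> \<open>\<open>y\<close> lies outside the arc from node \<open>j\<close> to node
    \<open>b\<close>, so it sees both on one branch, where the cotangent decreases. For
    \<open>j = N\<close> the far end is node 1 moved on by a full turn, which leaves the cotangent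
    unchanged.\<close>
  have cot_le: "cot (?u j / 2) \<le> cot (?u b / 2)"
  proof (cases "j = N")
    case True
    have "cot (?u j / 2) \<le> cot ((y - (w' b + 2 * pi)) / 2)"
    proof (rule cot_half_antimono)
      have eq: "w' b + 2 * pi = w' (Suc N)" using True b w' by (simp add: cyclic_nodes_def)
      show "same_branch (y - (w' b + 2 * pi)) (?u j)"
        using cyclic_nodes_arc(2)[OF w' ij(2,1) y(2)] cyclic_nodes_arc(1)[OF w' bN ij(1) y(2)]
          ij True b by (auto simp: same_branch_def)
      show "y - (w' b + 2 * pi) \<le> ?u j"
        unfolding eq using cyclic_nodes_mono[OF w', of j "Suc N"] ij by auto
    qed
    then show ?thesis by (simp only: cot_half_add_2pi)
  next
    case False
    show ?thesis
    proof (rule cot_half_antimono)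
      show "same_branch (?u b) (?u j)"
        using cyclic_nodes_arc[OF w' ij(2,1) y(2)] cyclic_nodes_arc[OF w' bN ij(1) y(2)] ij False b
        unfolding same_branch_def by (cases "i < j") auto
      show "?u b \<le> ?u j"
        using cyclic_nodes_mono[OF w', of j b] ij False b by auto
    qed
  qed
  have "ln (sin_prod N q w y) = (\<Sum>k = 1..N. q k * log_sin (?v k))"
    using sin_nonzero_arc[OF w _ ij(1) y(1)] by (rule ln_sin_prod)
  also have "\<dots> < (\<Sum>k = 1..N. q k * (log_sin (?u k) + cot (?u k / 2) / 2 * (?v k - ?u k)))"
  proof (rule sum_strict_mono_ex1)
    show "\<forall>k\<in>{1..N}. q k * log_sin (?v k) \<le> q k * (log_sin (?u k) + cot (?u k / 2) / 2 * (?v k - ?u k))"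
    proof
      fix k assume k: "k \<in> {1..N}"
      show "q k * log_sin (?v k) \<le> q k * (log_sin (?u k) + cot (?u k / 2) / 2 * (?v k - ?u k))"
        using less[OF k] q[OF k] by (intro mult_left_mono) (cases "?u k = ?v k", auto)
    qed
    show "\<exists>k\<in>{1..N}. q k * log_sin (?v k) < q k * (log_sin (?u k) + cot (?u k / 2) / 2 * (?v k - ?u k))"
      using less[OF ij(2)] q[OF ij(2)] ij(2) \<open>w' j \<noteq> w j\<close>
      by (intro bexI[of _ j] mult_strict_left_mono) auto
  qed simp
  also have "\<dots> = (\<Sum>k = 1..N. q k * log_sin (?u k)) +
      (\<Sum>k = 1..N. (if k = j then \<epsilon> / 2 * cot (?u j / 2) else 0) - (if k = b then \<epsilon> / 2 * cot (?u b / 2) else 0))"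
    unfolding sum.distrib[symmetric]
  proof (rule sum.cong[OF refl])
    fix k assume k: "k \<in> {1..N}"
    have "q k \<noteq> 0" using q[OF k] by simp
    moreover have "?v k - ?u k = \<epsilon> * ((if k = j then 1 / q j else 0) - (if k = b then 1 / q b else 0))"
      using move[OF k] by simp
    ultimately show "q k * (log_sin (?u k) + cot (?u k / 2) / 2 * (?v k - ?u k)) = q k * log_sin (?u k) +
      ((if k = j then \<epsilon> / 2 * cot (?u j / 2) else 0) - (if k = b then \<epsilon> / 2 * cot (?u b / 2) else 0))"
      by (auto simp: distrib_left)
  qed
  also have "\<dots> = (\<Sum>k = 1..N. q k * log_sin (?u k)) + \<epsilon> / 2 * (cot (?u j / 2) - cot (?u b / 2))"
    using ij bN by (simp add: sum_subtractf right_diff_distrib)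
  also have "\<dots> \<le> (\<Sum>k = 1..N. q k * log_sin (?u k))"
    using cot_le eps by (simp add: mult_nonneg_nonpos)
  also have "\<dots> = ln (sin_prod N q w' y)"
    using sin_nonzero_arc[OF w' _ ij(1) y(2)] by (rule ln_sin_prod[symmetric])
  finally show ?thesis
    using sin_prod_pos[of N y w q] sin_nonzero_arc[OF w _ ij(1) y(1)]
      sin_prod_pos[of N y w' q] sin_nonzero_arc[OF w' _ ij(1) y(2)] by simp
qed

lemma ex_arc:
  assumes t: "cyclic_nodes N t" and N: "N \<ge> 1" and x: "x \<in> {t 1..t (Suc N)}"
  obtains j where "j \<in> {1..N}" "x \<in> {t j..t (Suc j)}"
proof -
  define j where "j = Max {j \<in> {1..N}. t j \<le> x}"
  have "j \<in> {j \<in> {1..N}. t j \<le> x}"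
    unfolding j_def using x N by (intro Max_in) auto
  then have j: "j \<in> {1..N}" "t j \<le> x" by auto
  have "x \<le> t (Suc j)"
  proof (cases "j = N")
    case False
    show ?thesis
    proof (rule ccontr)
      assume "\<not> ?thesis"
      then have "Suc j \<le> j"
        using j False by (subst (2) j_def, intro Max_ge) auto
      then show False by simp
    qed
  qed (use x in auto)
  with j that show ?thesis by auto
qed

text \<open>The sample points are held fixed while the nodes move, so only values at fixed points
  have to be compared, not arc maxima.\<close>

lemma ex_equioscillating_nodes:
  assumes N: "N \<ge> 2" and q: "\<And>k. k \<in> {1..N} \<Longrightarrow> q k > 0"
  obtains w y M where "cyclic_nodes N w" "\<And>j. j \<in> {1..N} \<Longrightarrow> y j \<in> {w j<..<w (Suc j)}"
    "\<And>j. j \<in> {1..N} \<Longrightarrow> M \<le> sin_prod N q w (y j)"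
    "\<And>x. x \<in> {w 1..w (Suc N)} \<Longrightarrow> sin_prod N q w x \<le> M"
proof -
  have N1: "N \<ge> 1" using N by simp
  obtain w y M where w: "cyclic_nodes N w" and y: "\<And>j. j \<in> {1..N} \<Longrightarrow> y j \<in> {w j..w (Suc j)}"
    and M: "\<And>j. j \<in> {1..N} \<Longrightarrow> M \<le> sin_prod N q w (y j)"
    and max: "\<And>t x m. cyclic_nodes N t \<Longrightarrow> (\<And>j. j \<in> {1..N} \<Longrightarrow> x j \<in> {t j..t (Suc j)}) \<Longrightarrow>
       (\<And>j. j \<in> {1..N} \<Longrightarrow> m \<le> sin_prod N q t (x j)) \<Longrightarrow> m \<le> M"
    using ex_maximin[where q = q, OF N1 q] by blast
  have "M > 0"
  proof -
    \<comment> \<open>Equally spaced nodes have no degenerate arc, so a positive level is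
      attainable.\<close>
    define t where "t k = 2 * pi * (real k - 1) / real N" for k
    have tS: "t k < t (Suc k)" for k
      using N by (simp add: t_def divide_strict_right_mono)
    have t: "cyclic_nodes N t"
      using N tS by (auto simp: cyclic_nodes_def less_imp_le) (auto simp: t_def)
    define x where "x j = (t j + t (Suc j)) / 2" for j
    have x: "x j \<in> {t j<..<t (Suc j)}" for j using tS[of j] by (auto simp: x_def)
    have "sin_prod N q t (x j) > 0" if "j \<in> {1..N}" for j
      using sin_nonzero_arc[OF t _ that x] by (intro sin_prod_pos)
    then obtain m where "m > 0" "\<And>j. j \<in> {1..N} \<Longrightarrow> m \<le> sin_prod N q t (x j)"
      using ex_strict_lower_bound[of "{1..N}" 0 "\<lambda>j. sin_prod N q t (x j)"] by auto
    moreover have "x j \<in> {t j..t (Suc j)}" for j using x[of j] by auto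
    ultimately show ?thesis using max[OF t, of x m] by force
  qed
  have interior: "x \<in> {w j<..<w (Suc j)}"
    if "j \<in> {1..N}" "x \<in> {w j..w (Suc j)}" "M \<le> sin_prod N q w x" for x j
  proof -
    have "x \<noteq> w j" "x \<noteq> w (Suc j)"
      using sin_prod_arc_end[OF w that(1), of q] that(3) \<open>M > 0\<close> by auto
    then show ?thesis using that(2) by auto
  qed
  have y': "y j \<in> {w j<..<w (Suc j)}" if "j \<in> {1..N}" for j
    using interior[OF that y[OF that] M[OF that]] .
  have "sin_prod N q w x \<le> M" if x: "x \<in> {w 1..w (Suc N)}" for x
  proof (rule ccontr)
    assume "\<not> ?thesis"
    then have big: "sin_prod N q w x > M" by simp
    obtain j where j: "j \<in> {1..N}" "x \<in> {w j..w (Suc j)}"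
      using ex_arc[OF w N1 x] .
    \<comment> \<open>The point \<open>x\<close> with too large a value becomes the sample of its
      arc; the other samples stay.\<close>
    define Y where "Y = y(j := x)"
    have Y: "Y i \<in> {w i<..<w (Suc i)}" if "i \<in> {1..N}" for i
      using y'[OF that] interior[OF j] big by (auto simp: Y_def)
    define b where "b = (if j = N then 1 else Suc j)"
    define e where "e k = (if k = j then 1 / q j else 0) - (if k = b then 1 / q b else 0)" for k
    \<comment> \<open>Index \<open>Suc N\<close> is the second copy of node 1 and has to move along
      with it.\<close>
    define d where "d = e(Suc N := e 1)"
    define W where "W \<epsilon> k = w k + \<epsilon> * d k" for \<epsilon> k
    have W0: "W 0 = w" by (auto simp: W_def)
    have tend: "((\<lambda>\<epsilon>. W \<epsilon> k) \<longlongrightarrow> w k) (at_right 0)" for k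
      unfolding W_def by (auto intro!: tendsto_eq_intros)
    \<comment> \<open>The samples are interior, so under small displacements each one remains in its
      own arc.\<close>
    have "\<forall>\<^sub>F \<epsilon> in at_right 0. \<forall>i\<in>{1..N}. W \<epsilon> i < Y i \<and> Y i < W \<epsilon> (Suc i)"
      using Y by (intro eventually_ball_finite ballI eventually_conj
          order_tendstoD(2)[OF tend] order_tendstoD(1)[OF tend]) auto
    moreover have "\<forall>\<^sub>F \<epsilon> in at_right 0. M < sin_prod N q (W \<epsilon>) x"
    proof -
      have "continuous_on UNIV (\<lambda>\<epsilon>. sin_prod N q (W \<epsilon>) x)"
        unfolding W_def by (intro sin_prod_continuous q continuous_intros)
      then have "isCont (\<lambda>\<epsilon>. sin_prod N q (W \<epsilon>) x) 0"
        by (simp add: continuous_on_eq_continuous_at)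
      then have "((\<lambda>\<epsilon>. sin_prod N q (W \<epsilon>) x) \<longlongrightarrow> sin_prod N q w x) (at 0)"
        by (simp add: isCont_def W0)
      then have "((\<lambda>\<epsilon>. sin_prod N q (W \<epsilon>) x) \<longlongrightarrow> sin_prod N q w x) (at_right 0)"
        by (rule filterlim_mono) (auto simp: at_le)
      then show ?thesis using big by (rule order_tendstoD(1))
    qed
    moreover have "\<forall>\<^sub>F \<epsilon> in at_right (0::real). \<epsilon> > 0"
      by (simp add: eventually_at_right_less)
    ultimately have "\<forall>\<^sub>F \<epsilon> in at_right 0. (\<forall>i\<in>{1..N}. W \<epsilon> i < Y i \<and> Y i < W \<epsilon> (Suc i)) \<and>
        M < sin_prod N q (W \<epsilon>) x \<and> \<epsilon> > 0"
      by eventually_elim auto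
    then obtain \<epsilon> where arc: "\<And>i. i \<in> {1..N} \<Longrightarrow> Y i \<in> {W \<epsilon> i<..<W \<epsilon> (Suc i)}"
      and Wx: "M < sin_prod N q (W \<epsilon>) x" and eps: "\<epsilon> > 0"
      using eventually_happens[of _ "at_right (0::real)"] by fastforce
    have "W \<epsilon> k \<le> W \<epsilon> (Suc k)" if "k \<in> {1..N}" for k
      using arc[OF that] by auto
    then have cW: "cyclic_nodes N (W \<epsilon>)"
      using w N by (auto simp: cyclic_nodes_def W_def d_def)
    have "M < sin_prod N q (W \<epsilon>) (Y i)" if i: "i \<in> {1..N}" for i
    proof (cases "i = j")
      case True
      then show ?thesis using Wx by (simp add: Y_def)
    next
      case False
      have "sin_prod N q w (Y i) < sin_prod N q (W \<epsilon>) (Y i)"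
        by (rule sin_prod_shrink_arc[OF w cW q i j(1) False Y[OF i] arc[OF i] b_def eps])
          (auto simp: W_def d_def e_def)
      then show ?thesis using M[OF i] False by (simp add: Y_def)
    qed
    then obtain m where "m > M" "\<And>i. i \<in> {1..N} \<Longrightarrow> m \<le> sin_prod N q (W \<epsilon>) (Y i)"
      using ex_strict_lower_bound[of "{1..N}" M "\<lambda>i. sin_prod N q (W \<epsilon>) (Y i)"] by auto
    moreover have "Y i \<in> {W \<epsilon> i..W \<epsilon> (Suc i)}" if "i \<in> {1..N}" for i using arc[OF that] by auto
    ultimately show False using max[OF cW, of Y m] by force
  qed
  with w y' M show ?thesis using that by blast
qed

section \<open>Reflection and the original extremal problem\<close>

lemma Tfun_eq_sin_prod: "Tfun n r tt x = sin_prod (2 * n) (node_exp n r) tt x"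
  by (simp add: Tfun_def sin_prod_def)

text \<open>The exponents form a palindrome; the symmetry of the minimizer rests on this.\<close>

lemma node_exp_reflect:
  assumes "k \<in> {1..2*n}"
  shows "node_exp n r (2 * n + 1 - k) = node_exp n r k"
proof (cases "k \<le> n")
  case True
  then have "2 * n + 1 - k - n = n + 1 - k" "\<not> 2 * n + 1 - k \<le> n" using assms by auto
  with True assms show ?thesis by (simp add: node_exp_def)
next
  case False
  then have "n + 1 - (2 * n + 1 - k) = k - n" using assms by simp
  with False assms show ?thesis by (auto simp: node_exp_def)
qed

lemma Tfun_reflect: "Tfun n r (\<lambda>k. 2 * pi - tt (2 * n + 1 - k)) x = Tfun n r tt (2 * pi - x)"
proof -
  have "Tfun n r (\<lambda>k. 2 * pi - tt (2 * n + 1 - k)) x =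
      (\<Prod>k = 1..2*n. \<bar>sin ((x - (2 * pi - tt (2 * n + 1 - (2 * n + 1 - k)))) / 2)\<bar> powr node_exp n r (2 * n + 1 - k))"
    unfolding Tfun_def
    by (subst prod.atLeastAtMost_rev) (simp add: add.commute)
  also have "\<dots> = Tfun n r tt (2 * pi - x)"
    unfolding Tfun_def
  proof (rule prod.cong[OF refl])
    fix k assume k: "k \<in> {1..2*n}"
    then have k': "2 * n + 1 - (2 * n + 1 - k) = k" by auto
    have "(x - (2 * pi - tt k)) / 2 = - ((2 * pi - x - tt k) / 2)" by (simp add: field_simps)
    then have "\<bar>sin ((x - (2 * pi - tt k)) / 2)\<bar> = \<bar>sin ((2 * pi - x - tt k) / 2)\<bar>"
      by (simp only: sin_minus abs_minus_cancel)
    then show "\<bar>sin ((x - (2 * pi - tt (2 * n + 1 - (2 * n + 1 - k)))) / 2)\<bar> powr node_exp n r (2 * n + 1 - k)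
        = \<bar>sin ((2 * pi - x - tt k) / 2)\<bar> powr node_exp n r k"
      unfolding k' node_exp_reflect[OF k] by simp
  qed
  finally show ?thesis .
qed

lemma supT_reflect: "supT n r (\<lambda>k. 2 * pi - tt (2 * n + 1 - k)) = supT n r tt"
proof -
  have "(\<lambda>x. 2 * pi - x) ` {0..2*pi} = {0..2*pi}" by simp
  then have "supT n r tt = (SUP x\<in>(\<lambda>x. 2 * pi - x) ` {0..2*pi}. Tfun n r tt x)"
    by (simp only: supT_def)
  then show ?thesis by (simp only: supT_def Tfun_reflect image_image)
qed

lemma admissible_reflect:
  assumes "n \<ge> 1" "admissible n tt"
  shows "admissible n (\<lambda>k. 2 * pi - tt (2 * n + 1 - k))"
  unfolding admissible_def
proof (intro conjI ballI)
  fix k assume k: "k \<in> {1..<2*n}"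
  have "tt (2 * n - k) \<le> tt (Suc (2 * n - k))"
    using assms k unfolding admissible_def by fastforce
  then show "2 * pi - tt (2 * n + 1 - k) \<le> 2 * pi - tt (2 * n + 1 - Suc k)"
    using k by (simp add: Suc_diff_le)
qed (use assms in \<open>auto simp: admissible_def\<close>)

text \<open>Admissibility leaves index \<open>Suc (2 * n)\<close> free, so the repeated first node
  is written there. The last arc is ordered because \<open>tt (2 * n)\<close> is at most
  \<open>2 * pi\<close> and \<open>tt 1\<close> is nonnegative.\<close>

lemma cyclic_nodes_admissible:
  assumes "n \<ge> 1" "admissible n tt"
  shows "cyclic_nodes (2 * n) (tt(Suc (2 * n) := tt 1 + 2 * pi))"
  using assms by (auto simp: cyclic_nodes_def admissible_def)

lemma cyclic_nodes_shift:
  assumes "cyclic_nodes N t"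
  shows "cyclic_nodes N (\<lambda>k. t k + c)"
  using assms by (auto simp: cyclic_nodes_def)

lemma Tfun_le_supT:
  assumes q: "\<And>k. k \<in> {1..2*n} \<Longrightarrow> node_exp n r k > 0" and x: "x \<in> {0..2*pi}"
  shows "Tfun n r tt x \<le> supT n r tt"
  unfolding supT_def using sin_prod_le_1[OF q]
  by (intro cSUP_upper x bdd_aboveI[of _ 1]) (auto simp: Tfun_eq_sin_prod)

theorem theorem13p4:
  fixes n :: nat and r :: "nat \<Rightarrow> real"
  assumes "n \<ge> 1" and "\<forall>k\<in>{1..n}. r k > 0"
  shows "\<exists>w. admissible n w
           \<and> supT n r w = (INF tt\<in>{tt. admissible n tt}. supT n r tt)
           \<and> (\<forall>v. admissible n v \<and> supT n r v = (INF tt\<in>{tt. admissible n tt}. supT n r tt)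
                  \<longrightarrow> (\<forall>k\<in>{1..2*n}. v k = w k))
           \<and> w 1 + (w (2*n) - 2*pi) = 0
           \<and> 0 < w 1 \<and> (\<forall>k\<in>{1..<2*n}. w k < w (Suc k)) \<and> w (2*n) < 2*pi
           \<and> (\<forall>k\<in>{1..n}. w k = 2*pi - w (2*n + 1 - k))"
proof -
  define N where "N = 2 * n"
  define q where "q = node_exp n r"
  have N: "N \<ge> 2" using assms(1) by (simp add: N_def)
  have q: "q k > 0" if "k \<in> {1..N}" for k
  proof (cases "k \<le> n")
    case True
    then have "n + 1 - k \<in> {1..n}" using that by auto
    then show ?thesis using assms(2) True by (simp add: q_def node_exp_def)
  next
    case False
    then have "k - n \<in> {1..n}" using that by (auto simp: N_def)
    then show ?thesis using assms(2) False by (simp add: q_def node_exp_def)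
  qed
  obtain w0 y0 M where w0: "cyclic_nodes N w0"
    and y0: "\<And>j. j \<in> {1..N} \<Longrightarrow> y0 j \<in> {w0 j<..<w0 (Suc j)}"
    and M0: "\<And>j. j \<in> {1..N} \<Longrightarrow> M \<le> sin_prod N q w0 (y0 j)"
    and top0: "\<And>x. x \<in> {w0 1..w0 (Suc N)} \<Longrightarrow> sin_prod N q w0 x \<le> M"
    using ex_equioscillating_nodes[where q = q, OF N q] by blast
  \<comment> \<open>This translation produces the normalization
    \<open>w 1 + w N = 2 * pi\<close>.\<close>
  define c where "c = pi - (w0 1 + w0 N) / 2"
  define w where "w k = w0 k + c" for k
  define y where "y j = y0 j + c" for j
  have w: "cyclic_nodes N w" unfolding w_def by (rule cyclic_nodes_shift[OF w0])
  have y: "y j \<in> {w j<..<w (Suc j)}" if "j \<in> {1..N}" for j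
    using y0[OF that] by (simp add: y_def w_def)
  have shift: "sin_prod N q w (x + c) = sin_prod N q w0 x" for x
    unfolding w_def by (rule sin_prod_shift)
  have M: "M \<le> sin_prod N q w (y j)" if "j \<in> {1..N}" for j
    using M0[OF that] by (simp add: y_def shift)
  have top: "sin_prod N q w x \<le> M" if "x \<in> {w 1..w (Suc N)}" for x
    using top0[of "x - c"] shift[of "x - c"] that by (simp add: w_def)
  have norm: "w 1 + w N = 2 * pi" by (simp add: w_def c_def)
  have w_end: "w (Suc N) = w 1 + 2 * pi" using w by (simp add: cyclic_nodes_def)
  have strict: "w k < w (Suc k)" if "k \<in> {1..N}" for k using y[OF that] by auto
  \<comment> \<open>The last arc gives \<open>w N < w 1 + 2 * pi\<close>; together with the
    normalization this yields both inequalities.\<close>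
  have w1: "w 1 > 0" and wN: "w N < 2 * pi"
    using strict[of N] N norm w_end by auto
  have adm: "admissible n w"
    unfolding admissible_def N_def[symmetric] using w1 wN norm strict by (auto simp: less_imp_le)
  have w1_le: "w 1 \<le> w N" using N by (intro cyclic_nodes_mono[OF w]) auto
  have supw: "supT n r w \<le> M"
    unfolding supT_def
  proof (rule cSUP_least)
    fix x :: real assume x: "x \<in> {0..2*pi}"
    show "Tfun n r w x \<le> M"
    \<comment> \<open>Points to the left of \<open>w 1\<close> are moved on by a full turn into the
      range covered by \<open>top\<close>.\<close>
    proof (cases "x \<ge> w 1")
      case True
      then show ?thesis using top[of x] x w1 w_end by (simp add: Tfun_eq_sin_prod N_def q_def)
    next
      case False
      then show ?thesis using top[of "x + 2 * pi"] x w1_le wN w_end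
        by (simp add: Tfun_eq_sin_prod sin_prod_periodic flip: N_def q_def)
    qed
  qed simp
  \<comment> \<open>This strict bound serves both minimality and uniqueness.\<close>
  have larger: "M < supT n r v" if v: "admissible n v" and k: "k \<in> {1..N}" "v k \<noteq> w k" for v k
  proof -
    define v' where "v' = v(Suc N := v 1 + 2 * pi)"
    have v': "cyclic_nodes N v'"
      unfolding v'_def N_def using assms(1) v by (rule cyclic_nodes_admissible)
    have eq: "v' i = v i" if "i \<in> {1..N}" for i using that by (auto simp: v'_def)
    have norm': "v' 1 + v' N = w 1 + w N"
      using v norm N eq[of 1] eq[of N] by (simp add: admissible_def N_def)
    have neq: "v' k \<noteq> w k" using k eq by simp
    obtain j x where jx: "j \<in> {1..N}" "x \<in> {v' 1..v' 1 + 2 * pi}"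
      "sin_prod N q w (y j) < sin_prod N q v' x"
      using cyclic_nodes_comparison[where q = q and y = y, OF v' w q norm' k(1) neq y] by blast
    have "M < Tfun n r v x"
      using M[OF jx(1)] jx(3) sin_prod_cong[of N v' v q x] eq
      by (simp add: Tfun_eq_sin_prod flip: N_def q_def)
    \<comment> \<open>The point \<open>x\<close> may lie beyond \<open>2 * pi\<close>; periodicity
      brings it back into the interval of the supremum.\<close>
    also have "\<exists>x'\<in>{0..2*pi}. Tfun n r v x' = Tfun n r v x"
    proof (cases "x \<le> 2 * pi")
      case True
      then show ?thesis using jx(2) v eq[of 1] N by (intro bexI[of _ x]) (auto simp: admissible_def)
    next
      case False
      have "v 1 \<le> 2 * pi"
        using cyclic_nodes_mono[OF v', of 1 N] v eq[of 1] eq[of N] N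
        by (auto simp: admissible_def N_def)
      then show ?thesis
        using False jx(2) eq[of 1] N sin_prod_periodic[of N q v "x - 2 * pi"]
        by (intro bexI[of _ "x - 2 * pi"]) (auto simp: Tfun_eq_sin_prod simp flip: N_def q_def)
    qed
    then have "Tfun n r v x \<le> supT n r v"
      using Tfun_le_supT[of n r _ v] q unfolding N_def q_def by metis
    finally show ?thesis .
  qed
  have least: "supT n r w \<le> supT n r v" if v: "admissible n v" for v
  proof (cases "\<exists>k\<in>{1..N}. v k \<noteq> w k")
    case True
    then show ?thesis using larger[OF v] supw by force
  next
    case False
    \<comment> \<open>The sequences may differ outside \<open>{1..N}\<close>, but the product reads
      only these indices.\<close>
    then have "Tfun n r v x = Tfun n r w x" for x
      using sin_prod_cong[of N v w q x] by (simp add: Tfun_eq_sin_prod flip: N_def q_def)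
    then show ?thesis by (simp add: supT_def)
  qed
  have inf: "(INF tt\<in>{tt. admissible n tt}. supT n r tt) = supT n r w"
    using adm least by (intro cInf_eq_minimum) auto
  have unique: "v k = w k" if "admissible n v" "supT n r v = supT n r w" "k \<in> {1..N}" for v k
    using larger[OF that(1,3)] that(2) supw by force
  have sym: "2 * pi - w (2 * n + 1 - k) = w k" if "k \<in> {1..N}" for k
    using unique[OF admissible_reflect[OF assms(1) adm] supT_reflect that] .
  show ?thesis
    unfolding inf
  proof (intro exI[of _ w] conjI allI impI ballI)
    show "v k = w k" if "admissible n v \<and> supT n r v = supT n r w" "k \<in> {1..2*n}" for v k
      using unique[of v k] that by (simp add: N_def)
    show "w k < w (Suc k)" if "k \<in> {1..<2*n}" for k
      using strict[of k] that by (simp add: N_def)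
    show "w k = 2 * pi - w (2 * n + 1 - k)" if "k \<in> {1..n}" for k
      using sym[of k] that by (simp add: N_def)
  qed (use adm w1 wN norm in \<open>simp_all add: N_def\<close>)
qed

end
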